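(* Let $\beta>0$, $0\le k_0<k_1$ and $\alpha,\varepsilon\in\mathbb{R}$, and set $$\alpha^L_{\beta,\varepsilon}=\frac{-(1+k_0)\big(\beta(\varepsilon-1)+k_0\varepsilon\big)}{k_0+\beta},\qquad \alpha^R_{\beta,\varepsilon}=\frac{-(1+k_1)\big(\beta(\varepsilon-1)+k_1\varepsilon\big)}{k_1+\beta}.$$ Suppose that either $\alpha(1-\beta)=0$, or $\alpha(1-\beta)\neq 0$ and ($\alpha\ge\alpha^L_{\beta,\varepsilon}$ or $\alpha\le\alpha^R_{\beta,\varepsilon}$). Then the piecewise smooth Welander system $$\dot T=1-T-k(\rho)T,\qquad \dot S=\beta(1-S)-k(\rho)S,\qquad \rho=-\alpha T+S,$$ with $k(\rho)=k_1$ if $\rho>\varepsilon$ and $k(\rho)=k_0$ if $\rho\le\varepsilon$, does not have crossing periodic orbits.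
   Context: The system is a planar piecewise linear (Filippov) system with discontinuity line $\Sigma=\{(T,S)\in\mathbb{R}^2: f(T,S)=0\}$, $f(T,S)=S-\alpha T-\varepsilon$. Let $Z^{+}$ (resp. $Z^{-}$) be the linear vector field on $\mathbb{R}^2$ obtained by setting $k=k_1$ (resp. $k=k_0$); the system is governed by $Z^+$ on $\{f>0\}$ and by $Z^-$ on $\{f<0\}$. For $p\in\Sigma$ write $Z^{\pm}f(p)=\langle\nabla f(p),Z^{\pm}(p)\rangle$. A point $p\in\Sigma$ is a crossing point if $Z^+f(p)\cdot Z^-f(p)>0$; the solution through a crossing point is obtained by concatenating the solution arcs of $Z^+$ and $Z^-$. A crossing periodic orbit is a closed orbit, made of arcs of trajectories of $Z^+$ in $\{f>0\}$ and of $Z^-$ in $\{f<0\}$, which meets $\Sigma$ in a nonempty finite set of points, all of which are crossing points. *)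

theory Defs
  imports "HOL-Analysis.Analysis"
begin

definition gradient :: "('a::real_inner \<Rightarrow> real) \<Rightarrow> 'a \<Rightarrow> 'a"
  where "gradient f p = (THE D. GDERIV f p :> D)"

definition lie_derivative :: "('a::real_inner \<Rightarrow> 'a) \<Rightarrow> ('a \<Rightarrow> real) \<Rightarrow> 'a \<Rightarrow> real"
  where "lie_derivative Z f p = gradient f p \<bullet> Z p"

definition crossing_point ::
  "('a::real_inner \<Rightarrow> real) \<Rightarrow> ('a \<Rightarrow> 'a) \<Rightarrow> ('a \<Rightarrow> 'a) \<Rightarrow> 'a \<Rightarrow> bool"
  where "crossing_point f Zp Zm p \<longleftrightarrow>
    f p = 0 \<and> lie_derivative Zp f p * lie_derivative Zm f p > 0"

text \<open>The curve solves the differential equation of \<open>Z\<close> on the closed interval (one-sidedly at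
  the ends); only the relative interior of the arc has to lie in \<open>U\<close>, so that the arc may end on
  the boundary of \<open>U\<close>.\<close>

definition trajectory_arc ::
  "('a::real_normed_vector \<Rightarrow> 'a) \<Rightarrow> 'a set \<Rightarrow> (real \<Rightarrow> 'a) \<Rightarrow> real \<Rightarrow> real \<Rightarrow> bool"
  where "trajectory_arc Z U \<gamma> a b \<longleftrightarrow>
    (\<forall>t\<in>{a..b}. (\<gamma> has_vector_derivative Z (\<gamma> t)) (at t within {a..b})) \<and>
    (\<forall>t\<in>{a<..<b}. \<gamma> t \<in> U)"

definition piecewise_arc ::
  "('a::real_normed_vector \<Rightarrow> real) \<Rightarrow> ('a \<Rightarrow> 'a) \<Rightarrow> ('a \<Rightarrow> 'a) \<Rightarrow>
    (real \<Rightarrow> 'a) \<Rightarrow> real \<Rightarrow> real \<Rightarrow> bool"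
  where "piecewise_arc f Zp Zm \<gamma> a b \<longleftrightarrow>
    trajectory_arc Zp {p. f p > 0} \<gamma> a b \<or> trajectory_arc Zm {p. f p < 0} \<gamma> a b"

text \<open>A concatenation of arcs: immediately before and immediately after every time the curve is a
  single arc of one of the two fields. On a compact time interval this amounts to finitely many
  arcs.\<close>

definition concatenated_trajectory ::
  "('a::real_normed_vector \<Rightarrow> real) \<Rightarrow> ('a \<Rightarrow> 'a) \<Rightarrow> ('a \<Rightarrow> 'a) \<Rightarrow> (real \<Rightarrow> 'a) \<Rightarrow> bool"
  where "concatenated_trajectory f Zp Zm \<gamma> \<longleftrightarrow>
    (\<forall>t. \<exists>\<delta>>0. piecewise_arc f Zp Zm \<gamma> (t - \<delta>) t \<and> piecewise_arc f Zp Zm \<gamma> t (t + \<delta>))"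

definition crossing_periodic_orbit ::
  "('a::real_inner \<Rightarrow> real) \<Rightarrow> ('a \<Rightarrow> 'a) \<Rightarrow> ('a \<Rightarrow> 'a) \<Rightarrow> 'a set \<Rightarrow> bool"
  where "crossing_periodic_orbit f Zp Zm \<Gamma> \<longleftrightarrow>
    (\<exists>\<gamma> P. P > 0 \<and> (\<forall>t. \<gamma> (t + P) = \<gamma> t) \<and>
      concatenated_trajectory f Zp Zm \<gamma> \<and> \<Gamma> = range \<gamma>) \<and>
    \<Gamma> \<inter> {p. f p = 0} \<noteq> {} \<and> finite (\<Gamma> \<inter> {p. f p = 0}) \<and>
    (\<forall>p \<in> \<Gamma> \<inter> {p. f p = 0}. crossing_point f Zp Zm p)"

definition welander_field ::
  "real \<Rightarrow> real \<Rightarrow> (real \<Rightarrow> real) \<Rightarrow> real \<times> real \<Rightarrow> real \<times> real"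
  where "welander_field \<alpha> \<beta> k = (\<lambda>(T, S). let \<rho> = - \<alpha> * T + S in
    (1 - T - k \<rho> * T, \<beta> * (1 - S) - k \<rho> * S))"

definition switch_k :: "real \<Rightarrow> real \<Rightarrow> real \<Rightarrow> real \<Rightarrow> real"
  where "switch_k k0 k1 \<epsilon> \<rho> = (if \<rho> > \<epsilon> then k1 else k0)"

definition switch_fun :: "real \<Rightarrow> real \<Rightarrow> real \<times> real \<Rightarrow> real"
  where "switch_fun \<alpha> \<epsilon> = (\<lambda>(T, S). S - \<alpha> * T - \<epsilon>)"

lemma gradient_switch_fun: "gradient (switch_fun \<alpha> \<epsilon>) p = (- \<alpha>, 1)"
proof -
  have g: "GDERIV (switch_fun \<alpha> \<epsilon>) p :> (- \<alpha>, 1)"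
    unfolding gderiv_def switch_fun_def case_prod_unfold
    by (auto intro!: derivative_eq_intros simp: inner_prod_def)
  show ?thesis
    unfolding gradient_def
  proof (rule the_equality)
    show "GDERIV (switch_fun \<alpha> \<epsilon>) p :> (- \<alpha>, 1)" by (fact g)
  next
    fix D assume "GDERIV (switch_fun \<alpha> \<epsilon>) p :> D"
    then have "(\<lambda>h. h \<bullet> D) = (\<lambda>h. h \<bullet> (- \<alpha>, 1))"
      using g unfolding gderiv_def by (rule has_derivative_unique)
    then show "D = (- \<alpha>, 1)"
      by (metis vector_eq_rdot inner_commute)
  qed
qed

definition Z_plus :: "real \<Rightarrow> real \<Rightarrow> real \<Rightarrow> real \<times> real \<Rightarrow> real \<times> real"
  where "Z_plus \<alpha> \<beta> k1 = welander_field \<alpha> \<beta> (\<lambda>_. k1)"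

definition Z_minus :: "real \<Rightarrow> real \<Rightarrow> real \<Rightarrow> real \<times> real \<Rightarrow> real \<times> real"
  where "Z_minus \<alpha> \<beta> k0 = welander_field \<alpha> \<beta> (\<lambda>_. k0)"

lemma welander_field_switch:
  "welander_field \<alpha> \<beta> (switch_k k0 k1 \<epsilon>) p =
    (if switch_fun \<alpha> \<epsilon> p > 0 then Z_plus \<alpha> \<beta> k1 p else Z_minus \<alpha> \<beta> k0 p)"
  by (cases p) (auto simp: welander_field_def switch_k_def switch_fun_def Z_plus_def
      Z_minus_def Let_def)

definition alpha_L :: "real \<Rightarrow> real \<Rightarrow> real \<Rightarrow> real"
  where "alpha_L k0 \<beta> \<epsilon> = - (1 + k0) * (\<beta> * (\<epsilon> - 1) + k0 * \<epsilon>) / (k0 + \<beta>)"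

definition alpha_R :: "real \<Rightarrow> real \<Rightarrow> real \<Rightarrow> real"
  where "alpha_R k1 \<beta> \<epsilon> = - (1 + k1) * (\<beta> * (\<epsilon> - 1) + k1 * \<epsilon>) / (k1 + \<beta>)"

end

theory Submission
  imports Defs
begin

text \<open>
  Both fields are linear and diagonal, so along an arc of \<^term>\<open>Z_plus \<alpha> \<beta> k1\<close> or
  \<^term>\<open>Z_minus \<alpha> \<beta> k0\<close> the switching function has the form \<open>c + A e\<^sup>-\<^sup>\<nu>\<^sup>t + B e\<^sup>-\<^sup>\<mu>\<^sup>t\<close>, where
  \<open>\<nu> = 1 + k\<close>, \<open>\<mu> = \<beta> + k\<close> and \<open>c\<close> is its value at the equilibrium of the field.  Call an arc that
  leaves the switching line transversally and returns to it transversally an excursion.  During an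
  excursion the slope of the switching function changes sign.  That slope is a combination of two
  exponentials and changes sign at most once, so after an excursion the function would, if the same field were
  followed for ever, keep moving monotonically from the line towards \<open>c\<close>.  Hence the equilibrium
  lies strictly on the opposite side of the line from the excursion, that is, it is virtual.  The
  sign change also needs two different exponents and a term in each of them, so \<open>\<alpha> (1 - \<beta>) \<noteq> 0\<close>.
  This is \<open>welander_excursion\<close>; it rests on the algebraic fact \<open>exp_sum_turning_forces_limit\<close>.

  A crossing periodic orbit contains excursions on both sides.  By periodicity the orbit hits the
  line again after any hit, and the arc up to the next hit is an excursion because crossing points
  are transversal (\<open>arc_to_next_hit\<close>); the sign condition at a crossing point forces consecutive
  excursions to lie on opposite sides.  Therefore both equilibria are virtual.  The equilibrium of
  the field with parameter \<open>k\<close> has a switching value with the sign of \<open>\<alpha>\<^sub>k - \<alpha>\<close>, where \<open>\<alpha>\<^sub>k\<close> is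
  the threshold \<open>\<alpha>\<^sup>L\<close> for \<open>k = k\<^sub>0\<close> and \<open>\<alpha>\<^sup>R\<close> for \<open>k = k\<^sub>1\<close>, so the hypothesis says precisely that
  one of the two equilibria is not virtual, or that \<open>\<alpha> (1 - \<beta>) = 0\<close>.
\<close>

section \<open>Arcs between consecutive hits of the switching line\<close>

lemma trajectory_arc_one_sided_derivatives:
  assumes "trajectory_arc Z U \<gamma> a b" and "a < b"
  shows "(\<gamma> has_vector_derivative Z (\<gamma> a)) (at_right a)"
    and "(\<gamma> has_vector_derivative Z (\<gamma> b)) (at_left b)"
  using assms unfolding trajectory_arc_def
  by (metis at_within_Icc_at_right atLeastAtMost_iff less_imp_le order_refl,
      metis at_within_Icc_at_left atLeastAtMost_iff less_imp_le order_refl)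

lemma trajectory_arc_inside: "trajectory_arc Z U \<gamma> a b \<Longrightarrow> a < t \<Longrightarrow> t < b \<Longrightarrow> \<gamma> t \<in> U"
  unfolding trajectory_arc_def by simp

lemma trajectory_arcI_one_sided:
  assumes "a < b"
    and right: "\<And>t. a \<le> t \<Longrightarrow> t < b \<Longrightarrow> (\<gamma> has_vector_derivative Z (\<gamma> t)) (at_right t)"
    and left: "\<And>t. a < t \<Longrightarrow> t \<le> b \<Longrightarrow> (\<gamma> has_vector_derivative Z (\<gamma> t)) (at_left t)"
    and inside: "\<And>t. a < t \<Longrightarrow> t < b \<Longrightarrow> \<gamma> t \<in> U"
  shows "trajectory_arc Z U \<gamma> a b"
  unfolding trajectory_arc_def
proof (intro conjI ballI)
  fix t assume t: "t \<in> {a..b}"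
  consider "t = a" | "t = b" | "a < t" "t < b" using t by force
  then show "(\<gamma> has_vector_derivative Z (\<gamma> t)) (at t within {a..b})"
  proof cases
    case 1
    then show ?thesis using right[of t] \<open>a < b\<close> by (simp add: at_within_Icc_at_right)
  next
    case 2
    then show ?thesis using left[of t] \<open>a < b\<close> by (simp add: at_within_Icc_at_left)
  next
    case 3
    then have "(\<gamma> has_vector_derivative Z (\<gamma> t)) (at t)"
      using right[of t] left[of t]
      unfolding has_vector_derivative_def has_derivative_within
      by (simp add: filterlim_split_at)
    then show ?thesis by (rule has_vector_derivative_at_within)
  qed
qed (use inside in auto)

lemma concatenated_trajectory_continuous:
  assumes "concatenated_trajectory f Zp Zm \<gamma>"
  shows "continuous_on UNIV \<gamma>"
proof (intro continuous_at_imp_continuous_on ballI)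
  fix t
  obtain \<delta> where \<delta>: "\<delta> > 0" "piecewise_arc f Zp Zm \<gamma> (t - \<delta>) t" "piecewise_arc f Zp Zm \<gamma> t (t + \<delta>)"
    using assms unfolding concatenated_trajectory_def by blast
  have "continuous (at_left t) \<gamma>"
    using \<delta> trajectory_arc_one_sided_derivatives(2)[of _ _ \<gamma> "t - \<delta>" t]
    unfolding piecewise_arc_def by (auto intro: has_vector_derivative_continuous)
  moreover have "continuous (at_right t) \<gamma>"
    using \<delta> trajectory_arc_one_sided_derivatives(1)[of _ _ \<gamma> t "t + \<delta>"]
    unfolding piecewise_arc_def by (auto intro: has_vector_derivative_continuous)
  ultimately show "isCont \<gamma> t" by (simp add: continuous_at_split)
qed

lemma concatenated_trajectory_swap:
  "concatenated_trajectory (\<lambda>p. - f p) Zm Zp \<gamma> \<longleftrightarrow> concatenated_trajectory f Zp Zm \<gamma>"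
  unfolding concatenated_trajectory_def piecewise_arc_def by (auto simp: disj_commute)

text \<open>The short arcs around a time are governed by the field of the side that the curve is on, so
  as long as the curve stays on one side they glue to a single arc.\<close>

lemma trajectory_arc_while_positive:
  assumes conc: "concatenated_trajectory f Zp Zm \<gamma>" and "a < b"
    and pos: "\<And>t. a < t \<Longrightarrow> t < b \<Longrightarrow> f (\<gamma> t) > 0"
  shows "trajectory_arc Zp {p. f p > 0} \<gamma> a b"
proof (rule trajectory_arcI_one_sided[OF \<open>a < b\<close>])
  fix t assume t: "a \<le> t" "t < b"
  obtain \<delta> where \<delta>: "\<delta> > 0" "piecewise_arc f Zp Zm \<gamma> t (t + \<delta>)"
    using conc unfolding concatenated_trajectory_def by blast
  obtain s where s: "t < s" "s < t + \<delta>" "s < b"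
    using dense[of t "min (t + \<delta>) b"] t \<delta>(1) by auto
  have "\<not> trajectory_arc Zm {p. f p < 0} \<gamma> t (t + \<delta>)"
    using pos[of s] s t trajectory_arc_inside[of Zm _ \<gamma> _ _ s] by fastforce
  then show "(\<gamma> has_vector_derivative Zp (\<gamma> t)) (at_right t)"
    using \<delta> trajectory_arc_one_sided_derivatives(1) unfolding piecewise_arc_def by force
next
  fix t assume t: "a < t" "t \<le> b"
  obtain \<delta> where \<delta>: "\<delta> > 0" "piecewise_arc f Zp Zm \<gamma> (t - \<delta>) t"
    using conc unfolding concatenated_trajectory_def by blast
  obtain s where s: "s < t" "t - \<delta> < s" "a < s"
    using dense[of "max (t - \<delta>) a" t] t \<delta>(1) by auto
  have "\<not> trajectory_arc Zm {p. f p < 0} \<gamma> (t - \<delta>) t"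
    using pos[of s] s t trajectory_arc_inside[of Zm _ \<gamma> _ _ s] by fastforce
  then show "(\<gamma> has_vector_derivative Zp (\<gamma> t)) (at_left t)"
    using \<delta> trajectory_arc_one_sided_derivatives(2) unfolding piecewise_arc_def by force
qed (use pos in auto)

lemma piecewise_arc_while_nonzero:
  assumes conc: "concatenated_trajectory f Zp Zm \<gamma>" and f: "continuous_on UNIV f" and "a < b"
    and nz: "\<And>t. a < t \<Longrightarrow> t < b \<Longrightarrow> f (\<gamma> t) \<noteq> 0"
  shows "piecewise_arc f Zp Zm \<gamma> a b"
proof -
  have "continuous_on {a<..<b} (\<lambda>t. f (\<gamma> t))"
    using continuous_on_compose2[OF f concatenated_trajectory_continuous[OF conc]]
    by (auto intro: continuous_on_subset)
  then have "connected ((\<lambda>t. f (\<gamma> t)) ` {a<..<b})"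
    by (intro connected_continuous_image) auto
  moreover have "0 \<notin> (\<lambda>t. f (\<gamma> t)) ` {a<..<b}" using nz by force
  ultimately have "\<not> (x \<le> 0 \<and> 0 \<le> y)"
    if "x \<in> (\<lambda>t. f (\<gamma> t)) ` {a<..<b}" "y \<in> (\<lambda>t. f (\<gamma> t)) ` {a<..<b}" for x y
    using that connectedD_interval by blast
  then have "\<not> (f (\<gamma> s) \<le> 0 \<and> 0 \<le> f (\<gamma> t))" if "s \<in> {a<..<b}" "t \<in> {a<..<b}" for s t
    using that by blast
  then have "(\<forall>t\<in>{a<..<b}. f (\<gamma> t) > 0) \<or> (\<forall>t\<in>{a<..<b}. f (\<gamma> t) < 0)"
    by (meson not_le)
  then show ?thesis
  proof
    assume "\<forall>t\<in>{a<..<b}. f (\<gamma> t) > 0"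
    then show ?thesis
      using trajectory_arc_while_positive[OF conc \<open>a < b\<close>] unfolding piecewise_arc_def by auto
  next
    assume "\<forall>t\<in>{a<..<b}. f (\<gamma> t) < 0"
    then have "trajectory_arc Zm {p. - f p > 0} \<gamma> a b"
      using conc \<open>a < b\<close>
      by (intro trajectory_arc_while_positive[where Zm = Zp])
        (auto simp: concatenated_trajectory_swap)
    then show ?thesis unfolding piecewise_arc_def by simp
  qed
qed

text \<open>A hit of the line is isolated in time, since the curve leaves it along an arc.  So the later
  hits up to a given one form a compact set, which has a least element.\<close>

lemma arc_to_next_hit:
  assumes conc: "concatenated_trajectory f Zp Zm \<gamma>" and f: "continuous_on UNIV f"
    and later: "a < c" "f (\<gamma> c) = 0"
  obtains b where "a < b" "f (\<gamma> b) = 0" "piecewise_arc f Zp Zm \<gamma> a b"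
proof -
  obtain \<delta> where \<delta>: "\<delta> > 0" "piecewise_arc f Zp Zm \<gamma> a (a + \<delta>)"
    using conc unfolding concatenated_trajectory_def by blast
  have nz: "f (\<gamma> t) \<noteq> 0" if "a < t" "t < a + \<delta>" for t
    using \<delta>(2) that trajectory_arc_inside[of _ _ \<gamma> _ _ t] unfolding piecewise_arc_def by fastforce
  define H where "H = {a + \<delta>..c} \<inter> (\<lambda>t. f (\<gamma> t)) -` {0}"
  have "continuous_on UNIV (\<lambda>t. f (\<gamma> t))"
    using continuous_on_compose2[OF f concatenated_trajectory_continuous[OF conc]] by auto
  then have "closed ((\<lambda>t. f (\<gamma> t)) -` {0})"
    by (intro closed_vimage) auto
  then have "compact H" unfolding H_def by (intro compact_Int_closed) auto
  moreover have "c \<in> H" using later nz[of c] by (cases "c < a + \<delta>") (auto simp: H_def)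
  ultimately obtain b where b: "b \<in> H" "\<And>t. t \<in> H \<Longrightarrow> b \<le> t"
    using compact_attains_inf[of H] by blast
  have "f (\<gamma> t) \<noteq> 0" if "a < t" "t < b" for t
    using nz[of t] b(2)[of t] b(1) that unfolding H_def by force
  then have "piecewise_arc f Zp Zm \<gamma> a b"
    using b(1) \<delta>(1) by (intro piecewise_arc_while_nonzero[OF conc f]) (auto simp: H_def)
  then show thesis using that[of b] b(1) \<delta>(1) by (auto simp: H_def)
qed

section \<open>Excursions of a linear Welander field\<close>

lemma continuous_on_switch_fun: "continuous_on UNIV (switch_fun \<alpha> \<epsilon>)"
  unfolding switch_fun_def case_prod_unfold by (intro continuous_intros)

lemma has_real_derivative_switch_fun_along:
  assumes "(\<gamma> has_vector_derivative Z (\<gamma> t)) (at t within I)"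
  shows "((\<lambda>t. switch_fun \<alpha> \<epsilon> (\<gamma> t)) has_real_derivative
           lie_derivative Z (switch_fun \<alpha> \<epsilon>) (\<gamma> t)) (at t within I)"
proof -
  note fst = bounded_linear.has_vector_derivative[OF bounded_linear_fst assms]
  note snd = bounded_linear.has_vector_derivative[OF bounded_linear_snd assms]
  show ?thesis
    using fst snd unfolding switch_fun_def case_prod_unfold lie_derivative_def
      gradient_switch_fun[unfolded switch_fun_def case_prod_unfold]
    by (auto intro!: derivative_eq_intros simp: has_real_derivative_iff_has_vector_derivative[symmetric]
        inner_prod_def)
qed

text \<open>The factor \<open>\<sigma> = \<plusminus>1\<close> selects the side of the line, so that both fields are treated at once.\<close>

lemma slopes_at_ends_of_arc:
  fixes \<alpha> \<epsilon> \<sigma> :: real and Z :: "real \<times> real \<Rightarrow> real \<times> real"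
  defines "L \<equiv> lie_derivative Z (switch_fun \<alpha> \<epsilon>)"
  assumes arc: "trajectory_arc Z {p. \<sigma> * switch_fun \<alpha> \<epsilon> p > 0} \<gamma> a b" and "a < b"
    and ends: "switch_fun \<alpha> \<epsilon> (\<gamma> a) = 0" "switch_fun \<alpha> \<epsilon> (\<gamma> b) = 0"
  shows "\<sigma> * L (\<gamma> a) \<ge> 0" and "\<sigma> * L (\<gamma> b) \<le> 0"
proof -
  let ?h = "\<lambda>t. \<sigma> * switch_fun \<alpha> \<epsilon> (\<gamma> t)"
  have der: "(?h has_real_derivative \<sigma> * L (\<gamma> t)) (at t within {a..b})" if "t \<in> {a..b}" for t
    using arc that unfolding trajectory_arc_def L_def
    by (intro DERIV_cmult has_real_derivative_switch_fun_along) auto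
  have pos: "?h t > 0" if "a < t" "t < b" for t
    using arc that unfolding trajectory_arc_def by auto
  show "\<sigma> * L (\<gamma> a) \<ge> 0"
  proof (rule ccontr)
    assume "\<not> \<sigma> * L (\<gamma> a) \<ge> 0"
    then obtain d where "d > 0" and d: "\<And>h. h > 0 \<Longrightarrow> a + h \<in> {a..b} \<Longrightarrow> h < d \<Longrightarrow> ?h (a + h) < ?h a"
      using has_real_derivative_neg_dec_right[OF der[of a]] \<open>a < b\<close> by force
    obtain h where "0 < h" "h < d" "h < b - a" using dense[of 0 "min d (b - a)"] \<open>d > 0\<close> \<open>a < b\<close> by auto
    then show False using d[of h] pos[of "a + h"] ends by simp
  qed
  show "\<sigma> * L (\<gamma> b) \<le> 0"
  proof (rule ccontr)
    assume "\<not> \<sigma> * L (\<gamma> b) \<le> 0"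
    then obtain d where "d > 0" and d: "\<And>h. h > 0 \<Longrightarrow> b - h \<in> {a..b} \<Longrightarrow> h < d \<Longrightarrow> ?h (b - h) < ?h b"
      using has_real_derivative_pos_inc_left[OF der[of b]] \<open>a < b\<close> by force
    obtain h where "0 < h" "h < d" "h < b - a" using dense[of 0 "min d (b - a)"] \<open>d > 0\<close> \<open>a < b\<close> by auto
    then show False using d[of h] pos[of "b - h"] ends by simp
  qed
qed

lemma linear_ode_solution:
  fixes x :: "real \<Rightarrow> real"
  assumes "a \<le> b" and "\<nu> \<noteq> 0"
    and ode: "\<And>t. t \<in> {a..b} \<Longrightarrow> (x has_real_derivative m - \<nu> * x t) (at t within {a..b})"
  shows "x a - m / \<nu> = (x b - m / \<nu>) * exp (\<nu> * (b - a))"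
proof -
  have "((\<lambda>t. (x t - m / \<nu>) * exp (\<nu> * t)) has_field_derivative 0) (at t within {a..b})"
    if "t \<in> {a..b}" for t
    by (rule derivative_eq_intros ode[OF that] refl)+ (use \<open>\<nu> \<noteq> 0\<close> in \<open>simp add: field_simps\<close>)
  then obtain c where "\<forall>t\<in>{a..b}. (x t - m / \<nu>) * exp (\<nu> * t) = c"
    using has_field_derivative_zero_constant[of "{a..b}"] by force
  then have "(x a - m / \<nu>) * exp (\<nu> * a) = (x b - m / \<nu>) * exp (\<nu> * b)"
    using \<open>a \<le> b\<close> by simp
  then show ?thesis by (simp add: right_diff_distrib exp_diff field_simps)
qed

text \<open>With the final time of an excursion moved to \<open>0\<close>, the function is \<open>c + A e\<^sup>-\<^sup>\<nu>\<^sup>t + B e\<^sup>-\<^sup>\<mu>\<^sup>t\<close>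
  and vanishes there with positive slope, while the slope at \<open>-\<tau>\<close> is negative.  The more slowly
  decaying term then outweighs the other one in the slope at the final time, and all the more
  afterwards; so the function increases from \<open>0\<close> to its limit \<open>c\<close>.\<close>

lemma exp_sum_turning_forces_limit:
  fixes \<nu> \<mu> \<tau> :: real
  assumes "\<nu> > 0" "\<mu> > 0" "\<tau> > 0"
    and zero: "c + A + B = 0"
    and late: "\<nu> * A + \<mu> * B < 0"
    and early: "\<nu> * A * exp (\<nu> * \<tau>) + \<mu> * B * exp (\<mu> * \<tau>) > 0"
  shows "c > 0" and "\<nu> \<noteq> \<mu>" and "A \<noteq> 0"
proof -
  \<comment> \<open>Scaling the early slope by the slower exponential isolates the faster mode, whose sign is then
    the sign of the change between the two slopes.\<close>
  have key: "A + B < 0" if "l > 0" "l < m" "l * A + m * B < 0"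
    "l * A * exp (l * \<tau>) + m * B * exp (m * \<tau>) > 0" for l m A B :: real
  proof -
    define r where "r = exp ((m - l) * \<tau>)"
    have r: "r > 1" using that \<open>\<tau> > 0\<close> by (simp add: r_def)
    have "exp (m * \<tau>) = exp (l * \<tau>) * r"
      by (simp add: r_def exp_add[symmetric] algebra_simps)
    then have "exp (l * \<tau>) * (l * A + m * B * r) > 0"
      using that(4) by (simp add: algebra_simps)
    then have "l * A + m * B * r > 0" by (simp add: zero_less_mult_iff)
    then have "(m * B) * (r - 1) > 0" using that(3) by (simp add: algebra_simps)
    then have "m * B > 0" using r by (simp add: zero_less_mult_iff)
    then have "B > 0" using that by (simp add: zero_less_mult_iff)
    then have "l * B < m * B" using that by simp
    then have "l * (A + B) < 0" using that(3) by (simp add: algebra_simps)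
    then show ?thesis using that(1) by (simp add: mult_less_0_iff)
  qed
  show ne: "\<nu> \<noteq> \<mu>"
  proof
    assume "\<nu> = \<mu>"
    then have "exp (\<mu> * \<tau>) * (\<nu> * A + \<mu> * B) > 0" using early by (simp add: algebra_simps)
    then show False using late by (simp add: zero_less_mult_iff)
  qed
  show "A \<noteq> 0" using late early by (auto simp: zero_less_mult_iff mult_less_0_iff)
  show "c > 0"
  proof (cases "\<nu> < \<mu>")
    case True
    then show ?thesis using key[of \<nu> \<mu> A B] assms by simp
  next
    case False
    then show ?thesis using key[of \<mu> \<nu> B A] ne assms by (simp add: add.commute)
  qed
qed

lemma switch_fun_equilibrium:
  assumes "1 + k > 0" and "\<beta> + k > 0"
  shows "switch_fun \<alpha> \<epsilon> (1 / (1 + k), \<beta> / (\<beta> + k)) = (alpha_L k \<beta> \<epsilon> - \<alpha>) / (1 + k)"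
proof -
  have "k + \<beta> \<noteq> 0" "\<beta> + k \<noteq> 0" "1 + k \<noteq> 0" using assms by auto
  then show ?thesis
    unfolding switch_fun_def alpha_L_def by (simp add: divide_simps) (simp add: algebra_simps)
qed

lemma alpha_R_eq_alpha_L: "alpha_R = alpha_L"
  by (intro ext) (simp add: alpha_R_def alpha_L_def)

text \<open>The sign condition on \<open>\<sigma>\<close> says that the equilibrium is virtual, because the switching function
  there is a positive multiple of \<open>\<alpha>\<^sub>k - \<alpha>\<close>.  Transversality makes the weak slope signs at the ends
  of an arc strict, which is what the argument on two exponentials needs.\<close>

lemma welander_excursion:
  fixes \<alpha> \<beta> \<epsilon> \<sigma> k :: real
  defines "F \<equiv> switch_fun \<alpha> \<epsilon>" and "Z \<equiv> welander_field \<alpha> \<beta> (\<lambda>_. k)"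
  assumes k: "1 + k > 0" "\<beta> + k > 0"
    and arc: "trajectory_arc Z {p. \<sigma> * F p > 0} \<gamma> a b" and "a < b"
    and ends: "F (\<gamma> a) = 0" "F (\<gamma> b) = 0"
    and transversal: "\<sigma> * lie_derivative Z F (\<gamma> a) \<noteq> 0" "\<sigma> * lie_derivative Z F (\<gamma> b) \<noteq> 0"
  shows "\<sigma> * (alpha_L k \<beta> \<epsilon> - \<alpha>) < 0" and "\<alpha> * (1 - \<beta>) \<noteq> 0"
proof -
  define \<nu> \<mu> \<tau> where "\<nu> = 1 + k" and "\<mu> = \<beta> + k" and "\<tau> = b - a"
  have pos: "\<nu> > 0" "\<mu> > 0" "\<tau> > 0" using k \<open>a < b\<close> by (auto simp: \<nu>_def \<mu>_def \<tau>_def)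
  define u v where "u t = fst (\<gamma> t) - 1 / \<nu>" and "v t = snd (\<gamma> t) - \<beta> / \<mu>" for t
  have der: "(\<gamma> has_vector_derivative Z (\<gamma> t)) (at t within {a..b})" if "t \<in> {a..b}" for t
    using arc that unfolding trajectory_arc_def by blast
  have Z: "Z p = (1 - \<nu> * fst p, \<beta> - \<mu> * snd p)" for p
    by (simp add: Z_def welander_field_def case_prod_unfold \<nu>_def \<mu>_def algebra_simps)
  have "((\<lambda>t. fst (\<gamma> t)) has_real_derivative 1 - \<nu> * fst (\<gamma> t)) (at t within {a..b})"
    if "t \<in> {a..b}" for t
    using bounded_linear.has_vector_derivative[OF bounded_linear_fst der[OF that]]
    by (simp add: Z has_real_derivative_iff_has_vector_derivative)
  then have ua: "u a = u b * exp (\<nu> * \<tau>)"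
    unfolding u_def \<tau>_def using pos \<open>a < b\<close> by (intro linear_ode_solution) auto
  have "((\<lambda>t. snd (\<gamma> t)) has_real_derivative \<beta> - \<mu> * snd (\<gamma> t)) (at t within {a..b})"
    if "t \<in> {a..b}" for t
    using bounded_linear.has_vector_derivative[OF bounded_linear_snd der[OF that]]
    by (simp add: Z has_real_derivative_iff_has_vector_derivative)
  then have va: "v a = v b * exp (\<mu> * \<tau>)"
    unfolding v_def \<tau>_def using pos \<open>a < b\<close> by (intro linear_ode_solution) auto
  have slope: "lie_derivative Z F (\<gamma> t) = \<nu> * \<alpha> * u t - \<mu> * v t" for t
    using pos unfolding lie_derivative_def F_def gradient_switch_fun Z u_def v_def
    by (simp add: inner_prod_def field_simps)
  have slopes: "\<sigma> * (\<nu> * \<alpha> * u a - \<mu> * v a) > 0" "\<sigma> * (\<nu> * \<alpha> * u b - \<mu> * v b) < 0"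
    using slopes_at_ends_of_arc[OF arc[unfolded F_def] \<open>a < b\<close> ends[unfolded F_def]]
      transversal[unfolded F_def] slope[unfolded F_def] by (simp_all add: less_le)
  \<comment> \<open>The value at the end of the arc, split into the equilibrium value and the two decaying modes.\<close>
  have split: "F (1 / \<nu>, \<beta> / \<mu>) - \<alpha> * u b + v b = F (\<gamma> b)"
    by (simp add: F_def switch_fun_def u_def v_def case_prod_unfold algebra_simps)
  have zero: "- \<sigma> * F (1 / \<nu>, \<beta> / \<mu>) + \<sigma> * \<alpha> * u b + - \<sigma> * v b = 0"
    using arg_cong[OF split, of "\<lambda>x. - \<sigma> * x"] ends(2) by (simp add: algebra_simps)
  have late: "\<nu> * (\<sigma> * \<alpha> * u b) + \<mu> * (- \<sigma> * v b) < 0"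
    using slopes(2) by (simp add: algebra_simps)
  have early: "\<nu> * (\<sigma> * \<alpha> * u b) * exp (\<nu> * \<tau>) + \<mu> * (- \<sigma> * v b) * exp (\<mu> * \<tau>) > 0"
    using slopes(1) by (simp add: ua va algebra_simps)
  note turn = exp_sum_turning_forces_limit[OF pos zero late early]
  have "\<sigma> * ((alpha_L k \<beta> \<epsilon> - \<alpha>) / \<nu>) < 0"
    using turn(1) switch_fun_equilibrium[OF k] by (simp add: F_def \<nu>_def \<mu>_def)
  then show "\<sigma> * (alpha_L k \<beta> \<epsilon> - \<alpha>) < 0"
    using pos(1) by (simp add: divide_less_0_iff)
  show "\<alpha> * (1 - \<beta>) \<noteq> 0"
    using turn(2,3) by (auto simp: \<nu>_def \<mu>_def)
qed

section \<open>Crossing periodic orbits\<close>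

text \<open>At a crossing point the two fields point to the same side, so an arc that arrives from one side
  is continued on the other one.\<close>

lemma crossing_periodic_orbit_has_both_excursions:
  fixes \<alpha> \<epsilon> :: real
  defines "F \<equiv> switch_fun \<alpha> \<epsilon>"
  assumes orbit: "crossing_periodic_orbit F Zp Zm \<Gamma>"
  obtains \<gamma> a b c d where
    "trajectory_arc Zp {p. F p > 0} \<gamma> a b" "a < b" "crossing_point F Zp Zm (\<gamma> a)"
      "crossing_point F Zp Zm (\<gamma> b)"
    "trajectory_arc Zm {p. F p < 0} \<gamma> c d" "c < d" "crossing_point F Zp Zm (\<gamma> c)"
      "crossing_point F Zp Zm (\<gamma> d)"
proof -
  obtain \<gamma> P where P: "P > 0" "\<And>t. \<gamma> (t + P) = \<gamma> t"
    and conc: "concatenated_trajectory F Zp Zm \<gamma>" and \<Gamma>: "\<Gamma> = range \<gamma>"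
    using orbit unfolding crossing_periodic_orbit_def by blast
  have cross: "crossing_point F Zp Zm (\<gamma> t)" if "F (\<gamma> t) = 0" for t
    using orbit that \<Gamma> unfolding crossing_periodic_orbit_def by auto
  have nextarc: "\<exists>b>a. F (\<gamma> b) = 0 \<and> piecewise_arc F Zp Zm \<gamma> a b" if "F (\<gamma> a) = 0" for a
    by (rule arc_to_next_hit[OF conc, of a "a + P"])
      (use P that continuous_on_switch_fun in \<open>auto simp: F_def\<close>)
  obtain a where a: "F (\<gamma> a) = 0"
    using orbit \<Gamma> unfolding crossing_periodic_orbit_def by auto
  obtain b where b: "a < b" "F (\<gamma> b) = 0" "piecewise_arc F Zp Zm \<gamma> a b"
    using nextarc[OF a] by blast
  obtain c where c: "b < c" "F (\<gamma> c) = 0" "piecewise_arc F Zp Zm \<gamma> b c"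
    using nextarc[OF b(2)] by blast
  let ?plus = "trajectory_arc Zp {p. F p > 0} \<gamma>" and ?minus = "trajectory_arc Zm {p. F p < 0} \<gamma>"
  have Lb: "lie_derivative Zp F (\<gamma> b) * lie_derivative Zm F (\<gamma> b) > 0"
    using cross[OF b(2)] unfolding crossing_point_def by blast
  have "\<not> (?plus a b \<and> ?plus b c)"
  proof
    assume "?plus a b \<and> ?plus b c"
    then have "lie_derivative Zp F (\<gamma> b) \<le> 0" "lie_derivative Zp F (\<gamma> b) \<ge> 0"
      using slopes_at_ends_of_arc(2)[of Zp 1 \<alpha> \<epsilon> \<gamma> a b] slopes_at_ends_of_arc(1)[of Zp 1 \<alpha> \<epsilon> \<gamma> b c]
        a b c unfolding F_def by simp_all
    then show False using Lb by simp
  qed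
  moreover have "\<not> (?minus a b \<and> ?minus b c)"
  proof
    assume "?minus a b \<and> ?minus b c"
    then have "lie_derivative Zm F (\<gamma> b) \<le> 0" "lie_derivative Zm F (\<gamma> b) \<ge> 0"
      using slopes_at_ends_of_arc(1)[of Zm "-1" \<alpha> \<epsilon> \<gamma> b c] slopes_at_ends_of_arc(2)[of Zm "-1" \<alpha> \<epsilon> \<gamma> a b]
        a b c unfolding F_def by simp_all
    then show False using Lb by simp
  qed
  ultimately have "?plus a b \<and> ?minus b c \<or> ?minus a b \<and> ?plus b c"
    using b(3) c(3) unfolding piecewise_arc_def by blast
  then show thesis
    using that a b c cross by blast
qed

theorem theorem1:
  fixes \<alpha> \<beta> \<epsilon> k0 k1 :: real
  assumes "\<beta> > 0" and "0 \<le> k0" and "k0 < k1"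
    and "\<alpha> * (1 - \<beta>) = 0 \<or>
      (\<alpha> * (1 - \<beta>) \<noteq> 0 \<and> (\<alpha> \<ge> alpha_L k0 \<beta> \<epsilon> \<or> \<alpha> \<le> alpha_R k1 \<beta> \<epsilon>))"
  shows "\<not> (\<exists>\<Gamma>. crossing_periodic_orbit (switch_fun \<alpha> \<epsilon>) (Z_plus \<alpha> \<beta> k1) (Z_minus \<alpha> \<beta> k0) \<Gamma>)"
proof
  let ?F = "switch_fun \<alpha> \<epsilon>" and ?Zp = "Z_plus \<alpha> \<beta> k1" and ?Zm = "Z_minus \<alpha> \<beta> k0"
  assume "\<exists>\<Gamma>. crossing_periodic_orbit ?F ?Zp ?Zm \<Gamma>"
  then obtain \<gamma> a b c d where
    plus: "trajectory_arc ?Zp {p. ?F p > 0} \<gamma> a b" "a < b" "crossing_point ?F ?Zp ?Zm (\<gamma> a)"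
      "crossing_point ?F ?Zp ?Zm (\<gamma> b)" and
    minus: "trajectory_arc ?Zm {p. ?F p < 0} \<gamma> c d" "c < d" "crossing_point ?F ?Zp ?Zm (\<gamma> c)"
      "crossing_point ?F ?Zp ?Zm (\<gamma> d)"
    using crossing_periodic_orbit_has_both_excursions by metis
  have "1 * (alpha_L k1 \<beta> \<epsilon> - \<alpha>) < 0"
    using assms(1-3) plus
    by (intro welander_excursion(1)[where \<gamma> = \<gamma> and a = a and b = b])
      (auto simp: crossing_point_def Z_plus_def[symmetric])
  moreover have "- 1 * (alpha_L k0 \<beta> \<epsilon> - \<alpha>) < 0"
    using assms(1-3) minus
    by (intro welander_excursion(1)[where \<gamma> = \<gamma> and a = c and b = d])
      (auto simp: crossing_point_def Z_minus_def[symmetric])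
  moreover have "\<alpha> * (1 - \<beta>) \<noteq> 0"
    using assms(1-3) plus
    by (intro welander_excursion(2)[where \<sigma> = 1 and k = k1 and \<gamma> = \<gamma> and a = a and b = b])
      (auto simp: crossing_point_def Z_plus_def[symmetric])
  ultimately show False
    using assms(4) by (simp add: alpha_R_eq_alpha_L)
qed

end
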